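(* Let $\mathbb{K}$ be an algebraically closed field of characteristic $0$ and let $(\mathcal{A},\mu)$ be a left alternative $\mathbb{K}$-algebra. Let $\delta^1:\mathcal{C}^1(\mathcal{A},\mathcal{A})\to\mathcal{C}^2(\mathcal{A},\mathcal{A})$ and $\delta^2:\mathcal{C}^2(\mathcal{A},\mathcal{A})\to\mathcal{C}^3(\mathcal{A},\mathcal{A})$ be the first and second left alternative differentials. Then the composite $\delta^2\circ\delta^1$ is zero.
   Context: A left alternative $\mathbb{K}$-algebra is a $\mathbb{K}$-vector space $\mathcal{A}$ with a bilinear multiplication $\mu$ (not assumed associative or unital) satisfying $\mu(x,\mu(x,y))=\mu(\mu(x,x),y)$ for all $x,y$; equivalently $\mu(x,\mu(y,z))-\mu(\mu(x,y),z)+\mu(y,\mu(x,z))-\mu(\mu(y,x),z)=0$ for all $x,y,z\in\mathcal{A}$. $\mathcal{C}^p(\mathcal{A},\mathcal{A})$ is the space of linear maps $\mathcal{A}^{\otimes p}\to\mathcal{A}$ ($p$-cochains). For $f\in\mathcal{C}^1(\mathcal{A},\mathcal{A})$: $\delta^1 f=\mu\circ(f\otimes\mathrm{id})+\mu\circ(\mathrm{id}\otimes f)-f\circ\mu$. For $\phi\in\mathcal{C}^2(\mathcal{A},\mathcal{A})$: $\delta^2\phi=[\mu\circ(\phi\otimes\mathrm{id}-\mathrm{id}\otimes\phi)+\phi\circ(\mu\otimes\mathrm{id}-\mathrm{id}\otimes\mu)]\circ(\mathrm{id}^{\otimes 3}+\sigma_1)$, where $\sigma_1(x\otimes y\otimes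 z)=y\otimes x\otimes z$. *)

theory Defs
  imports "HOL-Computational_Algebra.Polynomial"
begin

text \<open>
  A linear map out of a tensor power is represented by the curried multilinear map
  that it induces on elementary tensors. Composites with maps between tensor powers are
  accordingly given by their values on elementary tensors, which determine them.
\<close>

definition cochains1 :: "('k::field \<Rightarrow> 'a::ab_group_add \<Rightarrow> 'a) \<Rightarrow> ('a \<Rightarrow> 'a) set" where
  "cochains1 scale = {f. Vector_Spaces.linear scale scale f}"

definition cochains2 :: "('k::field \<Rightarrow> 'a::ab_group_add \<Rightarrow> 'a) \<Rightarrow> ('a \<Rightarrow> 'a \<Rightarrow> 'a) set" where
  "cochains2 scale = {\<phi>.
     (\<forall>y. Vector_Spaces.linear scale scale (\<lambda>x. \<phi> x y)) \<and>
     (\<forall>x. Vector_Spaces.linear scale scale (\<lambda>y. \<phi> x y))}"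

definition cochains3 :: "('k::field \<Rightarrow> 'a::ab_group_add \<Rightarrow> 'a) \<Rightarrow> ('a \<Rightarrow> 'a \<Rightarrow> 'a \<Rightarrow> 'a) set" where
  "cochains3 scale = {\<psi>.
     (\<forall>y z. Vector_Spaces.linear scale scale (\<lambda>x. \<psi> x y z)) \<and>
     (\<forall>x z. Vector_Spaces.linear scale scale (\<lambda>y. \<psi> x y z)) \<and>
     (\<forall>x y. Vector_Spaces.linear scale scale (\<lambda>z. \<psi> x y z))}"

locale left_alternative_algebra = vector_space scale
  for scale :: "'k::field \<Rightarrow> 'a::ab_group_add \<Rightarrow> 'a" +
  fixes \<mu> :: "'a \<Rightarrow> 'a \<Rightarrow> 'a"
  assumes mult_bilinear: "\<mu> \<in> cochains2 scale"
    and left_alternative: "\<mu> x (\<mu> x y) = \<mu> (\<mu> x x) y"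

definition delta1 :: "('a \<Rightarrow> 'a \<Rightarrow> 'a) \<Rightarrow> ('a \<Rightarrow> 'a) \<Rightarrow> 'a \<Rightarrow> 'a \<Rightarrow> 'a::ab_group_add" where
  "delta1 \<mu> f = (\<lambda>x y. \<mu> (f x) y + \<mu> x (f y) - f (\<mu> x y))"

text \<open>Precomposition with \<open>id\<^sup>\<otimes>\<^sup>3 + \<sigma>\<^sub>1\<close>, where \<open>\<sigma>\<^sub>1 (x \<otimes> y \<otimes> z) = y \<otimes> x \<otimes> z\<close>.\<close>

definition precomp_id_plus_sigma1 ::
  "('a \<Rightarrow> 'a \<Rightarrow> 'a \<Rightarrow> 'a) \<Rightarrow> 'a \<Rightarrow> 'a \<Rightarrow> 'a \<Rightarrow> 'a::ab_group_add" where
  "precomp_id_plus_sigma1 \<psi> = (\<lambda>x y z. \<psi> x y z + \<psi> y x z)"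

definition delta2 ::
  "('a \<Rightarrow> 'a \<Rightarrow> 'a) \<Rightarrow> ('a \<Rightarrow> 'a \<Rightarrow> 'a) \<Rightarrow> 'a \<Rightarrow> 'a \<Rightarrow> 'a \<Rightarrow> 'a::ab_group_add" where
  "delta2 \<mu> \<phi> = precomp_id_plus_sigma1
     (\<lambda>x y z. (\<mu> (\<phi> x y) z - \<mu> x (\<phi> y z)) + (\<phi> (\<mu> x y) z - \<phi> x (\<mu> y z)))"

context left_alternative_algebra
begin

lemma delta1_in_cochains2: "f \<in> cochains1 scale \<Longrightarrow> delta1 \<mu> f \<in> cochains2 scale"
  using mult_bilinear
  by (simp add: cochains1_def cochains2_def delta1_def Vector_Spaces.linear_iff algebra_simps)

lemma delta2_in_cochains3: "\<phi> \<in> cochains2 scale \<Longrightarrow> delta2 \<mu> \<phi> \<in> cochains3 scale"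
  using mult_bilinear
  by (simp add: cochains2_def cochains3_def delta2_def precomp_id_plus_sigma1_def
      Vector_Spaces.linear_iff algebra_simps)

end

end

theory Submission
  imports Defs
begin

text \<open>
  Expanding \<open>\<delta>\<^sup>1 f\<close> inside the associator expression of \<open>\<delta>\<^sup>2\<close>, the terms containing \<open>f\<close> of a
  product that is then multiplied cancel. Writing \<open>S x y z\<close> for the associator symmetrized in its
  first two arguments, what is left is \<open>S (f x) y z + S x (f y) z + S x y (f z) - f (S x y z)\<close>,
  and \<open>S = 0\<close> is the linearized left alternative law.
\<close>

context left_alternative_algebra
begin

lemma mult_add_left: "\<mu> (x + y) z = \<mu> x z + \<mu> y z"
  and mult_add_right: "\<mu> x (y + z) = \<mu> x y + \<mu> x z"
  using mult_bilinear by (simp_all add: cochains2_def Vector_Spaces.linear_iff)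

lemma additive_mult_left: "additive (\<lambda>x. \<mu> x z)"
  and additive_mult_right: "additive (\<mu> x)"
  by (simp_all add: additive_def mult_add_left mult_add_right)

lemmas mult_diff_left = additive.diff [OF additive_mult_left]
lemmas mult_diff_right = additive.diff [OF additive_mult_right]

definition associator :: "'a \<Rightarrow> 'a \<Rightarrow> 'a \<Rightarrow> 'a" where
  "associator x y z = \<mu> (\<mu> x y) z - \<mu> x (\<mu> y z)"

text \<open>Polarization: in the left alternative law at \<open>x + y\<close>, the terms quadratic
  in \<open>x\<close> or in \<open>y\<close> cancel by the law at \<open>x\<close> and at
  \<open>y\<close>; the mixed terms remain.\<close>

lemma associator_swap: "associator x y z + associator y x z = 0"
proof -
  have "\<mu> (x + y) (\<mu> (x + y) z) = \<mu> (\<mu> (x + y) (x + y)) z"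
    by (rule left_alternative)
  then show ?thesis
    by (simp add: associator_def mult_add_left mult_add_right left_alternative algebra_simps)
qed

lemma delta2_delta1:
  assumes "additive f"
  shows "delta2 \<mu> (delta1 \<mu> f) x y z =
    (associator (f x) y z + associator y (f x) z) +
    (associator x (f y) z + associator (f y) x z) +
    (associator x y (f z) + associator y x (f z)) -
    f (associator x y z + associator y x z)"
  \<comment> \<open>The cancellation happens before symmetrizing:
    \<open>\<mu> (f (\<mu> x y)) z\<close> and \<open>\<mu> x (f (\<mu> y z))\<close> each occur
    twice, with opposite signs.\<close>
  by (simp add: delta2_def delta1_def precomp_id_plus_sigma1_def associator_def
      mult_add_left mult_add_right mult_diff_left mult_diff_right
      additive.add [OF assms] additive.diff [OF assms] algebra_simps)

lemma delta2_delta1_eq_0: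
  assumes "f \<in> cochains1 scale"
  shows "delta2 \<mu> (delta1 \<mu> f) = (\<lambda>x y z. 0)"
proof -
  have "additive f"
    using assms by (simp add: cochains1_def Vector_Spaces.linear_iff additive_def)
  then show ?thesis
    \<comment> \<open>Each symmetrized pair vanishes, and the last term becomes
      \<open>f 0 = 0\<close>.\<close>
    by (simp add: fun_eq_iff delta2_delta1 associator_swap additive.zero)
qed

end

theorem proposition4p2:
  fixes scale :: "'k::{alg_closed_field, field_char_0} \<Rightarrow> 'a::ab_group_add \<Rightarrow> 'a"
    and \<mu> :: "'a \<Rightarrow> 'a \<Rightarrow> 'a"
  assumes "left_alternative_algebra scale \<mu>"
  shows "\<forall>f \<in> cochains1 scale. (delta2 \<mu> \<circ> delta1 \<mu>) f = (\<lambda>x y z. 0)"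
  using left_alternative_algebra.delta2_delta1_eq_0 [OF assms] by simp

end
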